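(* Let $\Omega\subset\mathbb{R}^2$ be a simply connected domain, let $n\ge 1$, and let $f=(f_1,\dots,f_n):\Omega\to\mathbb{R}^n$ be a $C^2$ map whose graph $(x,y)\mapsto(x,y,f_1(x,y),\dots,f_n(x,y))$ is a minimal surface in $\mathbb{R}^{n+2}$, with induced metric $E\,dx^2+2F\,dx\,dy+G\,dy^2$ and $\omega=\sqrt{EG-F^2}$. Then there exist functions $M,N:\Omega\to\mathbb{R}$ satisfying $$M_x=\frac{E}{\omega},\qquad M_y=\frac{F}{\omega},\qquad N_x=\frac{F}{\omega},\qquad N_y=\frac{G}{\omega},$$ such that the graph $(x,y)\mapsto(x,y,M(x,y),N(x,y))$ is a minimal gradient graph in $\mathbb{R}^2\times\mathbb{R}^2=\mathbb{R}^4$.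
   Context: $\mathbb{R}^{n+2}$ and $\mathbb{R}^4$ carry the Euclidean metrics; $\mathbb{R}^2\times\mathbb{R}^2$ is also equipped with its standard symplectic structure. For the graph of $f$, $E=1+\sum_k(\partial_x f_k)^2$, $F=\sum_k\partial_x f_k\,\partial_y f_k$, $G=1+\sum_k(\partial_y f_k)^2$; the graph is minimal (zero mean curvature) if and only if $G\,\partial_{xx}f_k-2F\,\partial_{xy}f_k+E\,\partial_{yy}f_k=0$ for all $k$. A graph $(x,y,M(x,y),N(x,y))$ over $\Omega$ is a gradient graph if $(M,N)=(h_x,h_y)$ for some function $h:\Omega\to\mathbb{R}$. "Minimal gradient graph" means a gradient graph that is a minimal surface in Euclidean $\mathbb{R}^4$. *)

theory Defs
  imports "HOL-Analysis.Analysis"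
begin

definition partial_x :: "(real \<times> real \<Rightarrow> 'a::real_normed_vector) \<Rightarrow> real \<times> real \<Rightarrow> 'a" where
  "partial_x f p = vector_derivative (\<lambda>t. f (t, snd p)) (at (fst p))"

definition partial_y :: "(real \<times> real \<Rightarrow> 'a::real_normed_vector) \<Rightarrow> real \<times> real \<Rightarrow> 'a" where
  "partial_y f p = vector_derivative (\<lambda>t. f (fst p, t)) (at (snd p))"

(* Meant for open S only: all partial derivatives of order up to k exist on S, and those
   of order k are continuous there.  Continuity of the lower-order ones follows for k > 0,
   because a map with continuous first partial derivatives is Frechet differentiable. *)
primrec Ck_on :: "nat \<Rightarrow> (real \<times> real \<Rightarrow> 'a::real_normed_vector) \<Rightarrow> (real \<times> real) set \<Rightarrow> bool" where
  "Ck_on 0 f S \<longleftrightarrow> continuous_on S f"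
| "Ck_on (Suc k) f S \<longleftrightarrow>
     (\<forall>(x, y)\<in>S. (\<lambda>t. f (t, y)) differentiable at x \<and> (\<lambda>t. f (x, t)) differentiable at y) \<and>
     Ck_on k (partial_x f) S \<and> Ck_on k (partial_y f) S"

(* Coefficients of the metric E dx^2 + 2 F dx dy + G dy^2 induced by a parametrized surface X. *)
definition metric_E :: "(real \<times> real \<Rightarrow> 'a::euclidean_space) \<Rightarrow> real \<times> real \<Rightarrow> real" where
  "metric_E X p = partial_x X p \<bullet> partial_x X p"

definition metric_F :: "(real \<times> real \<Rightarrow> 'a::euclidean_space) \<Rightarrow> real \<times> real \<Rightarrow> real" where
  "metric_F X p = partial_x X p \<bullet> partial_y X p"

definition metric_G :: "(real \<times> real \<Rightarrow> 'a::euclidean_space) \<Rightarrow> real \<times> real \<Rightarrow> real" where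
  "metric_G X p = partial_y X p \<bullet> partial_y X p"

definition area_density :: "(real \<times> real \<Rightarrow> 'a::euclidean_space) \<Rightarrow> real \<times> real \<Rightarrow> real" where
  "area_density X p = sqrt (metric_E X p * metric_G X p - (metric_F X p)\<^sup>2)"

definition tangent_plane :: "(real \<times> real \<Rightarrow> 'a::euclidean_space) \<Rightarrow> real \<times> real \<Rightarrow> 'a set" where
  "tangent_plane X p = span {partial_x X p, partial_y X p}"

(* The closest point of a subspace is the orthogonal projection onto it. *)
definition normal_part :: "(real \<times> real \<Rightarrow> 'a::euclidean_space) \<Rightarrow> real \<times> real \<Rightarrow> 'a \<Rightarrow> 'a" where
  "normal_part X p v = v - closest_point (tangent_plane X p) v"

(* H = (1/2) tr_g II, where II is the second fundamental form (the normal parts of the second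
   derivatives of X) and the inverse metric has the entries G, -F, E divided by E G - F^2. *)
definition mean_curvature :: "(real \<times> real \<Rightarrow> 'a::euclidean_space) \<Rightarrow> real \<times> real \<Rightarrow> 'a" where
  "mean_curvature X p =
     (1 / (2 * (metric_E X p * metric_G X p - (metric_F X p)\<^sup>2))) *\<^sub>R
       (metric_G X p *\<^sub>R normal_part X p (partial_x (partial_x X) p)
        - (2 * metric_F X p) *\<^sub>R normal_part X p (partial_y (partial_x X) p)
        + metric_E X p *\<^sub>R normal_part X p (partial_y (partial_y X) p))"

(* The second conjunct says that X is an immersion. *)
definition minimal_surface :: "(real \<times> real) set \<Rightarrow> (real \<times> real \<Rightarrow> 'a::euclidean_space) \<Rightarrow> bool" where
  "minimal_surface \<Omega> X \<longleftrightarrow>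
     Ck_on 2 X \<Omega> \<and>
     (\<forall>p\<in>\<Omega>. metric_E X p * metric_G X p - (metric_F X p)\<^sup>2 > 0) \<and>
     (\<forall>p\<in>\<Omega>. mean_curvature X p = 0)"

(* For f with values in real^'n the ambient space (real * real) * real^'n, with its product
   inner product, is Euclidean space of dimension n + 2. *)
definition graph_map :: "(real \<times> real \<Rightarrow> 'b) \<Rightarrow> real \<times> real \<Rightarrow> (real \<times> real) \<times> 'b" where
  "graph_map f p = (p, f p)"

lemma partial_graph_map:
  fixes f :: "real \<times> real \<Rightarrow> real ^ 'n"
  assumes "Ck_on (Suc k) f S" and "p \<in> S"
  shows "partial_x (graph_map f) p = ((1, 0), \<chi> k. partial_x (\<lambda>q. f q $ k) p)"
    and "partial_y (graph_map f) p = ((0, 1), \<chi> k. partial_y (\<lambda>q. f q $ k) p)"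
proof -
  obtain x y where p: "p = (x, y)" by (cases p)
  have d: "(\<lambda>t. f (t, y)) differentiable at x" "(\<lambda>t. f (x, t)) differentiable at y"
    using assms p by auto
  define a where "a = vector_derivative (\<lambda>t. f (t, y)) (at x)"
  define b where "b = vector_derivative (\<lambda>t. f (x, t)) (at y)"
  have a: "((\<lambda>t. f (t, y)) has_vector_derivative a) (at x)"
    and b: "((\<lambda>t. f (x, t)) has_vector_derivative b) (at y)"
    using d unfolding a_def b_def by (simp_all add: vector_derivative_works)
  have ak: "((\<lambda>t. f (t, y) $ k) has_vector_derivative a $ k) (at x)"
    and bk: "((\<lambda>t. f (x, t) $ k) has_vector_derivative b $ k) (at y)" for k
    using bounded_linear.has_vector_derivative[OF bounded_linear_vec_nth a]
      bounded_linear.has_vector_derivative[OF bounded_linear_vec_nth b] by auto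
  have "((\<lambda>t. ((t, y), f (t, y))) has_vector_derivative ((1, 0), a)) (at x)"
    by (intro has_vector_derivative_Pair a derivative_intros)
  moreover have "((\<lambda>t. ((x, t), f (x, t))) has_vector_derivative ((0, 1), b)) (at y)"
    by (intro has_vector_derivative_Pair b derivative_intros)
  ultimately show "partial_x (graph_map f) p = ((1, 0), \<chi> k. partial_x (\<lambda>q. f q $ k) p)"
    and "partial_y (graph_map f) p = ((0, 1), \<chi> k. partial_y (\<lambda>q. f q $ k) p)"
    using ak[THEN vector_derivative_at] bk[THEN vector_derivative_at]
    by (auto simp: partial_x_def partial_y_def graph_map_def p vec_eq_iff
        vector_derivative_at)
qed

lemma metric_graph_map:
  fixes f :: "real \<times> real \<Rightarrow> real ^ 'n"
  assumes "Ck_on 2 f S" and "p \<in> S"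
  shows "metric_E (graph_map f) p = 1 + (\<Sum>k\<in>UNIV. (partial_x (\<lambda>q. f q $ k) p)\<^sup>2)"
    and "metric_F (graph_map f) p =
           (\<Sum>k\<in>UNIV. partial_x (\<lambda>q. f q $ k) p * partial_y (\<lambda>q. f q $ k) p)"
    and "metric_G (graph_map f) p = 1 + (\<Sum>k\<in>UNIV. (partial_y (\<lambda>q. f q $ k) p)\<^sup>2)"
proof -
  have "Ck_on (Suc 1) f S" using assms(1) by (simp only: numeral_2_eq_2 One_nat_def)
  note d = partial_graph_map[OF this assms(2)]
  show "metric_E (graph_map f) p = 1 + (\<Sum>k\<in>UNIV. (partial_x (\<lambda>q. f q $ k) p)\<^sup>2)"
    and "metric_F (graph_map f) p =
           (\<Sum>k\<in>UNIV. partial_x (\<lambda>q. f q $ k) p * partial_y (\<lambda>q. f q $ k) p)"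
    and "metric_G (graph_map f) p = 1 + (\<Sum>k\<in>UNIV. (partial_y (\<lambda>q. f q $ k) p)\<^sup>2)"
    unfolding metric_E_def metric_F_def metric_G_def d
    by (simp_all add: inner_vec_def power2_eq_square)
qed

definition gradient_graph ::
    "(real \<times> real) set \<Rightarrow> (real \<times> real \<Rightarrow> real) \<Rightarrow> (real \<times> real \<Rightarrow> real) \<Rightarrow> bool" where
  "gradient_graph \<Omega> M N \<longleftrightarrow>
     (\<exists>h :: real \<times> real \<Rightarrow> real. \<forall>(x, y)\<in>\<Omega>.
        ((\<lambda>t. h (t, y)) has_real_derivative M (x, y)) (at x) \<and>
        ((\<lambda>t. h (x, t)) has_real_derivative N (x, y)) (at y))"

definition minimal_gradient_graph ::
    "(real \<times> real) set \<Rightarrow> (real \<times> real \<Rightarrow> real) \<Rightarrow> (real \<times> real \<Rightarrow> real) \<Rightarrow> bool" where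
  "minimal_gradient_graph \<Omega> M N \<longleftrightarrow>
     gradient_graph \<Omega> M N \<and> minimal_surface \<Omega> (graph_map (\<lambda>p. (M p, N p)))"

end

theory Submission
  imports Defs "HOL-Complex_Analysis.Riemann_Mapping"
begin

text \<open>
  Put \<open>p = E/\<omega>\<close>, \<open>q = F/\<omega>\<close>, \<open>r = G/\<omega>\<close>. The minimal surface equation for \<open>f\<close>, paired with \<open>f\<^sub>x\<close> and
  \<open>f\<^sub>y\<close>, says that the forms \<open>p dx + q dy\<close> and \<open>q dx + r dy\<close> are closed, so on the simply connected
  domain they have potentials \<open>M\<close> and \<open>N\<close>; then \<open>M dx + N dy\<close> is closed as well, and its potential \<open>h\<close>
  has \<open>(M, N)\<close> as gradient. The graph of \<open>(M, N)\<close> is minimal because \<open>p r - q\<^sup>2 = 1\<close>.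
  Potentials are constructed by integration along segments in a convex domain; the Riemann mapping
  theorem reduces the simply connected case to the disc.
\<close>

section \<open>Potentials of closed vector fields\<close>

text \<open>This is the Poincare lemma, with the potential obtained by integrating \<open>W\<close>
  along the segment from a base point \<open>a\<close> to \<open>z\<close>. After differentiation
  under the integral, symmetry of \<open>D\<close> makes the integrand the t-derivative of
  \<open>t * (W (c t z) \<bullet> u)\<close>, so the integral collapses to
  \<open>W z \<bullet> u\<close>.\<close>

lemma gradient_potential_convex:
  fixes W :: "'a::euclidean_space \<Rightarrow> 'a" and D :: "'a \<Rightarrow> 'a \<Rightarrow>\<^sub>L 'a"
  assumes S: "open S" "convex S"
    and W: "\<And>z. z \<in> S \<Longrightarrow> (W has_derivative D z) (at z)"
    and D: "continuous_on S D"
    and sym: "\<And>z u v. z \<in> S \<Longrightarrow> D z u \<bullet> v = D z v \<bullet> u"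
  shows "\<exists>h::'a \<Rightarrow> real. \<forall>z\<in>S. (h has_derivative (\<lambda>u. W z \<bullet> u)) (at z)"
proof (cases "S = {}")
  case False
  then obtain a where a: "a \<in> S" by auto
  define c where "c t z = a + t *\<^sub>R (z - a)" for t z
  have cS: "c t z \<in> S" if "z \<in> S" "t \<in> cbox 0 1" for t z
  proof -
    have "c t z = (1 - t) *\<^sub>R a + t *\<^sub>R z" by (simp add: c_def algebra_simps)
    then show ?thesis using that a S(2) by (auto simp: convex_alt)
  qed
  have contW: "continuous_on S W"
    using W by (meson continuous_at_imp_continuous_on has_derivative_continuous)
  define h where "h z = integral (cbox 0 1) (\<lambda>t::real. W (c t z) \<bullet> (z - a))" for z
  \<comment> \<open>This is the z-derivative of the integrand of \<open>h\<close>. It is a bounded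
    linear map as an object because the Leibniz rule integrates such maps over
    \<open>t\<close>.\<close>
  define dh where "dh z t = Blinfun (\<lambda>u. W (c t z) \<bullet> u + t * (D (c t z) u \<bullet> (z - a)))" for z t
  have bl: "bounded_linear (\<lambda>u. W (c t z) \<bullet> u + t * (D (c t z) u \<bullet> (z - a)))" for z t
    by (intro bounded_linear_intros)
  have dh: "blinfun_apply (dh z t) = (\<lambda>u. W (c t z) \<bullet> u + t * (D (c t z) u \<bullet> (z - a)))" for z t
    unfolding dh_def by (rule bounded_linear_Blinfun_apply[OF bl])
  have contc: "continuous_on (S \<times> cbox 0 1) (\<lambda>(z, t). c t z)"
    by (auto simp: c_def split_beta intro!: continuous_intros)
  have cont1: "continuous_on (S \<times> cbox 0 1) (\<lambda>x. W (c (snd x) (fst x)))"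
    "continuous_on (S \<times> cbox 0 1) (\<lambda>x. D (c (snd x) (fst x)))"
    using contc by (auto intro!: continuous_on_compose2[OF contW] continuous_on_compose2[OF D]
        cS simp: split_beta)
  have cont2: "continuous_on (cbox 0 1) (\<lambda>t. W (c t z))" "continuous_on (cbox 0 1) (\<lambda>t. D (c t z))"
    if "z \<in> S" for z
    using that by (auto intro!: continuous_on_compose2[OF contW] continuous_on_compose2[OF D]
        cS[unfolded c_def] continuous_intros simp: c_def[abs_def])
  have contdh: "continuous_on (S \<times> cbox 0 1) (\<lambda>(z, t). dh z t)"
    by (rule continuous_on_blinfun_componentwise)
      (auto simp: split_beta dh intro!: continuous_intros cont1[unfolded cbox_interval])
  have "(h has_derivative (\<lambda>u. W z \<bullet> u)) (at z)" if z: "z \<in> S" for z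
  proof -
    have "(h has_derivative integral (cbox 0 1) (dh z)) (at z within S)"
      unfolding h_def[abs_def]
    proof (rule leibniz_rule[OF _ _ contdh z S(2)])
      show "((\<lambda>z. W (c t z) \<bullet> (z - a)) has_derivative dh y t) (at y within S)"
        if "y \<in> S" "t \<in> cbox 0 1" for y t
      proof -
        have "((\<lambda>z. c t z) has_derivative (\<lambda>u. t *\<^sub>R u)) (at y within S)"
          unfolding c_def by (auto intro!: derivative_eq_intros)
        then have "((\<lambda>z. W (c t z)) has_derivative (\<lambda>u. D (c t y) (t *\<^sub>R u))) (at y within S)"
          by (rule has_derivative_compose[where f="\<lambda>z. c t z" and x=y, OF _ W[OF cS[OF that]]])
        moreover have "((\<lambda>z. z - a) has_derivative (\<lambda>u. u)) (at y within S)"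
          by (auto intro!: derivative_eq_intros)
        ultimately show ?thesis
          unfolding dh by (auto dest: has_derivative_inner simp: blinfun.scaleR_right)
      qed
      show "(\<lambda>t. W (c t y) \<bullet> (y - a)) integrable_on cbox 0 1" if "y \<in> S" for y
        using that by (intro integrable_continuous continuous_intros cont2)
    qed
    moreover have "blinfun_apply (integral (cbox 0 1) (dh z)) = (\<lambda>u. W z \<bullet> u)"
    proof
      fix u
      have "continuous_on (cbox 0 1) (dh z)"
        by (rule continuous_on_blinfun_componentwise)
          (auto simp: dh intro!: continuous_intros cont2[unfolded cbox_interval] z)
      then have int: "dh z integrable_on cbox 0 1" by (rule integrable_continuous)
      have "integral (cbox 0 1) (dh z) u = integral (cbox 0 1) (\<lambda>t. dh z t u)"
        using integral_linear[OF int, of "\<lambda>L. blinfun_apply L u"]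
        by (simp add: o_def bounded_linear_intros)
      \<comment> \<open>The antiderivative is \<open>t * (W (c t z) \<bullet> u)\<close>; its factor
        \<open>t\<close> removes the boundary term at \<open>a\<close>.\<close>
      moreover have "((\<lambda>t. dh z t u) has_integral 1 * (W (c 1 z) \<bullet> u) - 0 * (W (c 0 z) \<bullet> u)) {0..1}"
      proof (rule fundamental_theorem_of_calculus)
        fix t :: real assume t: "t \<in> {0..1}"
        have "((\<lambda>t. c t z) has_derivative (\<lambda>s. s *\<^sub>R (z - a))) (at t within {0..1})"
          unfolding c_def by (auto intro!: derivative_eq_intros)
        then have "((\<lambda>t. W (c t z)) has_derivative (\<lambda>s. D (c t z) (s *\<^sub>R (z - a)))) (at t within {0..1})"
          by (rule has_derivative_compose[where f="\<lambda>t. c t z" and x=t, OF _ W[OF cS[OF z]]]) (use t in auto)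
        then have "((\<lambda>t. t * (W (c t z) \<bullet> u)) has_derivative
            (\<lambda>s. t * (D (c t z) (s *\<^sub>R (z - a)) \<bullet> u) + s * (W (c t z) \<bullet> u))) (at t within {0..1})"
          by (intro has_derivative_mult has_derivative_ident has_derivative_inner_left)
        \<comment> \<open>Closedness of the form enters here: the direction \<open>z - a\<close> of
          the segment trades places with the direction \<open>u\<close> of differentiation.\<close>
        moreover have "D (c t z) (z - a) \<bullet> u = D (c t z) u \<bullet> (z - a)"
          by (rule sym[OF cS[OF z]]) (use t in auto)
        ultimately show "((\<lambda>t. t * (W (c t z) \<bullet> u)) has_vector_derivative dh z t u) (at t within {0..1})"
          by (simp add: has_vector_derivative_def dh blinfun.scaleR_right distrib_left ac_simps)
      qed simp
      ultimately show "integral (cbox 0 1) (dh z) u = W z \<bullet> u"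
        by (simp add: c_def integral_unique)
    qed
    ultimately show ?thesis by (simp only: at_within_open[OF z S(1)])
  qed
  then show ?thesis by blast
qed auto

text \<open>Multiplication by \<open>cnj a\<close> is the adjoint of multiplication by
  \<open>a\<close> for the real inner product on the complex plane. This moves the derivative of a
  holomorphic map from the tangent vector to the field.\<close>

lemma inner_cnj_mult_left: "(cnj a * w) \<bullet> u = w \<bullet> (a * u)" for a w u :: complex
  by (simp add: inner_complex_def algebra_simps)

text \<open>Under a holomorphic \<open>g\<close> the form \<open>W \<bullet> dz\<close> pulls back to \<open>(cnj g' * (W \<circ> g)) \<bullet> dz\<close>.\<close>

lemma gradient_potential_simply_connected:
  fixes W :: "complex \<Rightarrow> complex" and D :: "complex \<Rightarrow> complex \<Rightarrow>\<^sub>L complex"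
  assumes S: "open S" "simply_connected S"
    and W: "\<And>z. z \<in> S \<Longrightarrow> (W has_derivative D z) (at z)"
    and D: "continuous_on S D"
    and sym: "\<And>z u v. z \<in> S \<Longrightarrow> D z u \<bullet> v = D z v \<bullet> u"
  shows "\<exists>h::complex \<Rightarrow> real. \<forall>z\<in>S. (h has_derivative (\<lambda>u. W z \<bullet> u)) (at z)"
proof -
  \<comment> \<open>A simply connected open set is empty, the whole plane or biholomorphic to the
    unit disc; the first two are convex.\<close>
  consider "convex S" | f g where "f holomorphic_on S" "g holomorphic_on ball 0 1"
      "\<And>z. z \<in> S \<Longrightarrow> f z \<in> ball 0 1 \<and> g (f z) = z"
      "\<And>z. z \<in> ball 0 1 \<Longrightarrow> g z \<in> S \<and> f (g z) = z"
    using S Riemann_mapping_theorem[of S] by (metis convex_UNIV convex_empty)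
  then show ?thesis
  proof cases
    case 1
    then show ?thesis by (intro gradient_potential_convex[OF S(1) _ W D sym])
  next
    case 2
    let ?B = "ball 0 1 :: complex set"
    let ?g1 = "deriv g" and ?g2 = "deriv (deriv g)"
    have hol: "?g1 holomorphic_on ?B" "?g2 holomorphic_on ?B"
      using 2(2) by (auto intro!: holomorphic_deriv)
    have gS: "g w \<in> S" if "w \<in> ?B" for w using 2(4) that by blast
    have cont: "continuous_on ?B g" "continuous_on ?B ?g1" "continuous_on ?B ?g2"
      using 2(2) hol by (auto intro!: holomorphic_on_imp_continuous_on)
    have contW: "continuous_on S W"
      using W by (meson continuous_at_imp_continuous_on has_derivative_continuous)
    \<comment> \<open>\<open>V\<close> is the pullback of \<open>W\<close> along \<open>g\<close>,
      and \<open>E\<close> is its derivative by the product and chain rules.\<close>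
    define V where "V w = cnj (?g1 w) * W (g w)" for w
    define E where "E w = Blinfun (\<lambda>u. cnj (?g2 w * u) * W (g w) + cnj (?g1 w) * D (g w) (?g1 w * u))" for w
    have "bounded_linear (\<lambda>u. cnj (?g2 w * u) * W (g w) + cnj (?g1 w) * D (g w) (?g1 w * u))" for w
      by (intro bounded_linear_intros bounded_linear_compose[OF bounded_linear_cnj])
    then have E: "blinfun_apply (E w) = (\<lambda>u. cnj (?g2 w * u) * W (g w) + cnj (?g1 w) * D (g w) (?g1 w * u))" for w
      unfolding E_def by (rule bounded_linear_Blinfun_apply)
    have "\<exists>h::complex \<Rightarrow> real. \<forall>w\<in>?B. (h has_derivative (\<lambda>u. V w \<bullet> u)) (at w)"
    proof (rule gradient_potential_convex)
      fix w assume w: "w \<in> ?B"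
      have g1: "(g has_derivative (*) (?g1 w)) (at w)" and g2: "(?g1 has_derivative (*) (?g2 w)) (at w)"
        using 2(2) hol(1) w holomorphic_derivI[of _ ?B w] has_field_derivative_imp_has_derivative
        by (metis open_ball)+
      have "((\<lambda>w. W (g w)) has_derivative (\<lambda>u. D (g w) (?g1 w * u))) (at w)"
        by (rule has_derivative_compose[OF g1 W[OF gS[OF w]]])
      moreover have "((\<lambda>w. cnj (?g1 w)) has_derivative (\<lambda>u. cnj (?g2 w * u))) (at w)"
        using g2 by (rule bounded_linear.has_derivative[OF bounded_linear_cnj])
      ultimately show "(V has_derivative E w) (at w)"
        unfolding V_def[abs_def] E by (auto dest: has_derivative_mult simp: algebra_simps)
      show "E w u \<bullet> v = E w v \<bullet> u" for u v
      proof -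
        \<comment> \<open>The term with the second derivative of \<open>g\<close> is symmetric
          because complex multiplication commutes; the other term inherits symmetry from
          \<open>D\<close>.\<close>
        have "W (g w) \<bullet> (?g2 w * u * v) = W (g w) \<bullet> (?g2 w * v * u)" by (simp add: ac_simps)
        then show ?thesis
          unfolding E using sym[OF gS[OF w], of "?g1 w * u" "?g1 w * v"]
          by (simp only: inner_add_left inner_cnj_mult_left)
      qed
    next
      have "continuous_on ?B (\<lambda>w. W (g w))" "continuous_on ?B (\<lambda>w. D (g w))"
        using gS by (auto intro: continuous_on_compose2[OF contW cont(1)] continuous_on_compose2[OF D cont(1)])
      then show "continuous_on ?B E"
        by (intro continuous_on_blinfun_componentwise, unfold E)
          (intro continuous_on_add continuous_on_mult continuous_on_cnj continuous_on_const
            blinfun.continuous_on cont)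
    qed auto
    then obtain H :: "complex \<Rightarrow> real" where H: "\<And>w. w \<in> ?B \<Longrightarrow> (H has_derivative (\<lambda>u. V w \<bullet> u)) (at w)"
      by blast
    have "((\<lambda>z. H (f z)) has_derivative (\<lambda>u. W z \<bullet> u)) (at z)" if z: "z \<in> S" for z
    proof -
      have f: "(f has_field_derivative deriv f z) (at z)"
        by (rule holomorphic_derivI[OF 2(1) S(1) z])
      have g: "(g has_field_derivative ?g1 (f z)) (at (f z))"
        using 2(2,3) z by (intro holomorphic_derivI[of _ ?B]) auto
      \<comment> \<open>As \<open>f\<close> and \<open>g\<close> are mutually inverse, their
        derivatives multiply to 1, which cancels the factor introduced by the pullback.\<close>
      have "((\<lambda>z. g (f z)) has_field_derivative ?g1 (f z) * deriv f z) (at z)"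
        using DERIV_chain2[OF g f] .
      moreover have "((\<lambda>z. g (f z)) has_field_derivative 1) (at z)"
        by (rule has_field_derivative_transform_within_open[OF DERIV_ident S(1) z]) (use 2(3) in auto)
      ultimately have 1: "?g1 (f z) * deriv f z = 1" by (rule DERIV_unique)
      have "((\<lambda>z. H (f z)) has_derivative (\<lambda>u. V (f z) \<bullet> (deriv f z * u))) (at z)"
        using has_derivative_compose[OF has_field_derivative_imp_has_derivative[OF f] H[of "f z"]] 2(3) z by auto
      moreover have "V (f z) \<bullet> (deriv f z * u) = W z \<bullet> u" for u
        using 1 2(3)[OF z] by (simp add: V_def inner_cnj_mult_left flip: mult.assoc)
      ultimately show ?thesis by simp
    qed
    then show ?thesis by blast
  qed
qed

section \<open>Functions with continuous partial derivatives\<close>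

text \<open>The partial derivatives are explicit arguments rather than \<open>partial_x f\<close>
  and \<open>partial_y f\<close>, so that the product and quotient rules return formulas. Only their
  values on \<open>S\<close> matter.\<close>

definition has_C1_partials ::
    "(real \<times> real \<Rightarrow> 'a::real_normed_vector) \<Rightarrow> (real \<times> real \<Rightarrow> 'a) \<Rightarrow> (real \<times> real \<Rightarrow> 'a) \<Rightarrow>
     (real \<times> real) set \<Rightarrow> bool" where
  "has_C1_partials f fx fy S \<longleftrightarrow>
     (\<forall>x y. (x, y) \<in> S \<longrightarrow>
        ((\<lambda>t. f (t, y)) has_vector_derivative fx (x, y)) (at x) \<and>
        ((\<lambda>t. f (x, t)) has_vector_derivative fy (x, y)) (at y)) \<and>
     continuous_on S fx \<and> continuous_on S fy"

lemma has_C1_partialsD: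
  assumes "has_C1_partials f fx fy S"
  shows "(x, y) \<in> S \<Longrightarrow> ((\<lambda>t. f (t, y)) has_vector_derivative fx (x, y)) (at x)"
    and "(x, y) \<in> S \<Longrightarrow> ((\<lambda>t. f (x, t)) has_vector_derivative fy (x, y)) (at y)"
    and "continuous_on S fx" and "continuous_on S fy"
  using assms by (auto simp: has_C1_partials_def)

lemma open_contains_rectangle:
  fixes S :: "(real \<times> real) set"
  assumes "open S" "(x, y) \<in> S"
  obtains e where "e > 0" "{x-e..x+e} \<times> {y-e..y+e} \<subseteq> S"
proof -
  obtain A B where AB: "open A" "open B" "x \<in> A" "y \<in> B" "A \<times> B \<subseteq> S"
    using open_prod_elim[OF assms] by (metis mem_Sigma_iff)
  obtain d1 d2 where d: "d1 > 0" "cball x d1 \<subseteq> A" "d2 > 0" "cball y d2 \<subseteq> B"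
    using AB by (meson open_contains_cball)
  show ?thesis
  proof (rule that[of "min d1 d2"])
    have "cball x (min d1 d2) \<subseteq> A" "cball y (min d1 d2) \<subseteq> B"
      using d subset_cball by (metis min.cobounded1 min.cobounded2 order_trans)+
    then show "{x - min d1 d2..x + min d1 d2} \<times> {y - min d1 d2..y + min d1 d2} \<subseteq> S"
      using AB(5) unfolding cball_eq_atLeastAtMost by blast
  qed (use d in simp)
qed

lemma has_C1_partials_has_derivative:
  assumes S: "open S" "p \<in> S" and f: "has_C1_partials f fx fy S"
  shows "(f has_derivative (\<lambda>u. fst u *\<^sub>R fx p + snd u *\<^sub>R fy p)) (at p)"
proof -
  obtain x y where p: "p = (x, y)" by (cases p)
  obtain e where e: "e > 0" "{x-e..x+e} \<times> {y-e..y+e} \<subseteq> S"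
    using open_contains_rectangle S p by metis
  \<comment> \<open>\<open>has_derivative_partialsI\<close> works on a product with convex second
    factor, hence the open rectangle.\<close>
  define X Y where "X = {x-e<..<x+e}" and "Y = {y-e<..<y+e}"
  have sub: "X \<times> Y \<subseteq> S" using e(2) by (force simp: X_def Y_def)
  have xy: "x \<in> X" "y \<in> Y" and op: "open (X \<times> Y)"
    using e(1) by (auto simp: X_def Y_def open_Times)
  have "((\<lambda>(x, y). f (x, y)) has_derivative
      (\<lambda>(tx, ty). tx *\<^sub>R fx (x, y) + blinfun_scaleR_left (fy (x, y)) ty)) (at (x, y) within X \<times> Y)"
  proof (rule has_derivative_partialsI)
    show "((\<lambda>x. f (x, y)) has_derivative (\<lambda>tx. tx *\<^sub>R fx (x, y))) (at x within X)"
      using has_C1_partialsD(1)[OF f] S(2) p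
      by (auto simp: has_vector_derivative_def intro: has_derivative_at_withinI)
    show "((\<lambda>y. f (x, y)) has_derivative blinfun_scaleR_left (fy (x, y))) (at y within Y)"
      if "x \<in> X" "y \<in> Y" for x y
      using has_C1_partialsD(2)[OF f subsetD[OF sub]] that
      by (auto simp: has_vector_derivative_def intro: has_derivative_at_withinI)
    have "continuous_on (X \<times> Y) (\<lambda>(x, y). blinfun_scaleR_left (fy (x, y)))"
      using continuous_on_subset[OF has_C1_partialsD(4)[OF f] sub]
      by (auto intro!: continuous_intros)
    then show "continuous (at (x, y) within X \<times> Y) (\<lambda>(x, y). blinfun_scaleR_left (fy (x, y)))"
      using xy unfolding continuous_on_eq_continuous_within by blast
  qed (use xy in \<open>auto simp: Y_def\<close>)
  then show ?thesis
    using xy op by (simp add: p at_within_open[of _ "X \<times> Y"] case_prod_unfold)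
qed

lemma has_C1_partials_continuous_on:
  assumes "open S" "has_C1_partials f fx fy S"
  shows "continuous_on S f"
  using has_C1_partials_has_derivative[OF assms(1) _ assms(2)]
  by (auto intro!: continuous_at_imp_continuous_on has_derivative_continuous)

text \<open>Differentiating \<open>f (x, y) - f (a, y) = integral {a..x} (\<lambda>s. fx (s, y))\<close> first in \<open>y\<close>,
  under the integral sign, and then in \<open>x\<close>.\<close>

lemma mixed_partials_eq:
  fixes f :: "real \<times> real \<Rightarrow> 'a::banach"
  assumes S: "open S" "p \<in> S"
    and f: "has_C1_partials f fx fy S"
    and fx: "has_C1_partials fx fxx fxy S" and fy: "has_C1_partials fy fyx fyy S"
  shows "fxy p = fyx p"
proof -
  obtain x0 y0 where p: "p = (x0, y0)" by (cases p)
  obtain e where e: "e > 0" "{x0-e..x0+e} \<times> {y0-e..y0+e} \<subseteq> S"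
    using open_contains_rectangle S p by metis
  define a b c d where "a = x0 - e" and "b = x0 + e" and "c = y0 - e" and "d = y0 + e"
  have sub: "{a..b} \<times> {c..d} \<subseteq> S" and x0: "x0 \<in> {a<..<b}" and y0: "y0 \<in> {c<..<d}"
    using e by (auto simp: a_def b_def c_def d_def)
  have contfx: "continuous_on S fx" by (rule has_C1_partials_continuous_on[OF S(1) fx])
  have cont: "continuous_on {a..b} (\<lambda>s. g (s, y0))" if "continuous_on S g" for g :: "_ \<Rightarrow> 'a"
    using sub y0 by (intro continuous_on_compose2[OF that] continuous_intros) auto
  have int: "fy (x, y0) = fy (a, y0) + integral {a..x} (\<lambda>s. fxy (s, y0))" if x: "x \<in> {a..b}" for x
  proof -
    have L: "((\<lambda>y. integral (cbox a x) (\<lambda>s. fx (s, y))) has_vector_derivative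
        integral (cbox a x) (\<lambda>s. fxy (s, y0))) (at y0 within {c<..<d})"
    proof (rule leibniz_rule_vector_derivative)
      fix y t assume "y \<in> {c<..<d}" "t \<in> cbox a x"
      then show "((\<lambda>y. fx (t, y)) has_vector_derivative fxy (t, y)) (at y within {c<..<d})"
        using x by (intro has_vector_derivative_at_within[OF has_C1_partialsD(2)[OF fx subsetD[OF sub]]]) auto
    next
      fix y assume "y \<in> {c<..<d}"
      then show "(\<lambda>s. fx (s, y)) integrable_on cbox a x"
        using sub x
        by (intro integrable_continuous continuous_on_compose2[OF contfx] continuous_on_Pair
            continuous_on_id continuous_on_const) auto
    next
      show "continuous_on ({c<..<d} \<times> cbox a x) (\<lambda>(y, t). fxy (t, y))"
        using sub x unfolding split_beta
        by (intro continuous_on_compose2[OF has_C1_partialsD(4)[OF fx]] continuous_on_Pair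
            continuous_on_fst continuous_on_snd continuous_on_id) auto
    qed (use y0 in auto)
    have I: "integral (cbox a x) (\<lambda>s. fx (s, y)) = f (x, y) - f (a, y)" if "y \<in> {c<..<d}" for y
    proof -
      have "((\<lambda>s. fx (s, y)) has_integral f (x, y) - f (a, y)) {a..x}"
      proof (rule fundamental_theorem_of_calculus)
        fix s assume "s \<in> {a..x}"
        then show "((\<lambda>s. f (s, y)) has_vector_derivative fx (s, y)) (at s within {a..x})"
          using x that
          by (intro has_vector_derivative_at_within[OF has_C1_partialsD(1)[OF f subsetD[OF sub]]]) auto
      qed (use x in auto)
      then show ?thesis by (simp add: integral_unique)
    qed
    \<comment> \<open>The same y-derivative is computed twice, through the integral and directly
      through \<open>fy\<close>.\<close>
    have "((\<lambda>y. f (x, y) - f (a, y)) has_vector_derivative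
        integral (cbox a x) (\<lambda>s. fxy (s, y0))) (at y0)"
      using L unfolding at_within_open[OF y0 open_greaterThanLessThan]
      by (rule has_vector_derivative_transform_within_open[OF _ open_greaterThanLessThan y0 I])
    moreover have "((\<lambda>y. f (x, y) - f (a, y)) has_vector_derivative fy (x, y0) - fy (a, y0)) (at y0)"
      using sub x y0 by (intro has_vector_derivative_diff has_C1_partialsD(2)[OF f]) auto
    ultimately have "integral (cbox a x) (\<lambda>s. fxy (s, y0)) = fy (x, y0) - fy (a, y0)"
      by (rule vector_derivative_unique_at)
    then show ?thesis by simp
  qed
  have "((\<lambda>x. fy (a, y0) + integral {a..x} (\<lambda>s. fxy (s, y0))) has_vector_derivative fxy (x0, y0))
      (at x0 within {a..b})"
    using x0 integral_has_vector_derivative[OF cont[OF has_C1_partialsD(4)[OF fx]], of x0]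
    by (simp add: has_vector_derivative_add_const add.commute[of "fy _"])
  then have "((\<lambda>x. fy (x, y0)) has_vector_derivative fxy (x0, y0)) (at x0 within {a..b})"
    by (rule has_vector_derivative_transform[rotated 2]) (use x0 in simp, erule int)
  then have "((\<lambda>x. fy (x, y0)) has_vector_derivative fxy (x0, y0)) (at x0)"
    using x0 by (simp add: at_within_Icc_at)
  moreover have "((\<lambda>x. fy (x, y0)) has_vector_derivative fyx (x0, y0)) (at x0)"
    using has_C1_partialsD(1)[OF fy] S(2) p by simp
  ultimately show ?thesis unfolding p by (rule vector_derivative_unique_at)
qed

text \<open>The form \<open>P dx + Q dy\<close> becomes the field \<open>P + i Q\<close> on the copy
  of \<open>S\<close> in the complex plane, where the Riemann mapping theorem is available. The
  condition \<open>Py = Qx\<close> is the symmetry of the Jacobian of that field.\<close>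

lemma closed_form_potential:
  fixes P Q :: "real \<times> real \<Rightarrow> real"
  assumes S: "open S" "simply_connected S"
    and P: "has_C1_partials P Px Py S" and Q: "has_C1_partials Q Qx Qy S"
    and closed: "\<And>p. p \<in> S \<Longrightarrow> Py p = Qx p"
  shows "\<exists>h. has_C1_partials h P Q S"
proof -
  define c where "c z = (Re z, Im z)" for z
  define T where "T = c -` S"
  have contc: "continuous_on A c" for A unfolding c_def[abs_def] by (intro continuous_intros)
  have oT: "open T" unfolding T_def using S(1) contc by (rule open_vimage)
  have contC: "continuous_on S (\<lambda>p. Complex (fst p) (snd p))"
    unfolding Complex_eq by (intro continuous_intros)
  have "homeomorphism T S c (\<lambda>p. Complex (fst p) (snd p))"
    by (rule homeomorphismI) (use contc[of T] in \<open>auto simp: contC T_def c_def\<close>)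
  then have "simply_connected T"
    using S(2) homeomorphic_simply_connected_eq unfolding homeomorphic_def by blast
  \<comment> \<open>Writing the field as a real combination of 1 and \<i> lets the rules for sums
    and scalar multiples differentiate it.\<close>
  define W where "W z = P (c z) *\<^sub>R 1 + Q (c z) *\<^sub>R \<i>" for z
  define D where "D z = Blinfun (\<lambda>u. (Re u * Px (c z) + Im u * Py (c z)) *\<^sub>R 1 +
      (Re u * Qx (c z) + Im u * Qy (c z)) *\<^sub>R \<i>)" for z
  have D: "blinfun_apply (D z) = (\<lambda>u. (Re u * Px (c z) + Im u * Py (c z)) *\<^sub>R 1 +
      (Re u * Qx (c z) + Im u * Qy (c z)) *\<^sub>R \<i>)" for z
    unfolding D_def
    by (intro bounded_linear_Blinfun_apply bounded_linear_intros bounded_linear_Re bounded_linear_Im)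
  have "\<exists>h::complex \<Rightarrow> real. \<forall>z\<in>T. (h has_derivative (\<lambda>u. W z \<bullet> u)) (at z)"
  proof (rule gradient_potential_simply_connected[OF oT \<open>simply_connected T\<close>])
    fix z assume "z \<in> T"
    then have z: "c z \<in> S" by (simp add: T_def)
    have dc: "(c has_derivative (\<lambda>u. (Re u, Im u))) (at z)"
      unfolding c_def[abs_def] by (auto intro!: derivative_eq_intros)
    have "((\<lambda>z. P (c z)) has_derivative (\<lambda>u. Re u * Px (c z) + Im u * Py (c z))) (at z)"
      "((\<lambda>z. Q (c z)) has_derivative (\<lambda>u. Re u * Qx (c z) + Im u * Qy (c z))) (at z)"
      using has_derivative_compose[OF dc has_C1_partials_has_derivative[OF S(1) z P]]
        has_derivative_compose[OF dc has_C1_partials_has_derivative[OF S(1) z Q]] by auto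
    then show "(W has_derivative D z) (at z)"
      unfolding W_def[abs_def] D by (intro has_derivative_add has_derivative_scaleR_left)
    show "D z u \<bullet> v = D z v \<bullet> u" for u v
      using closed[OF z] by (simp add: D inner_complex_def algebra_simps)
  next
    have "continuous_on T (\<lambda>z. g (c z))" if "continuous_on S g" for g :: "_ \<Rightarrow> real"
      by (rule continuous_on_compose2[OF that contc]) (auto simp: T_def)
    then show "continuous_on T D"
      using has_C1_partialsD(3,4)[OF P] has_C1_partialsD(3,4)[OF Q]
      by (intro continuous_on_blinfun_componentwise) (auto simp: D intro!: continuous_intros)
  qed
  then obtain h where h: "\<And>z. z \<in> T \<Longrightarrow> (h has_derivative (\<lambda>u. W z \<bullet> u)) (at z)" by blast
  have "has_C1_partials (\<lambda>p. h (Complex (fst p) (snd p))) P Q S"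
    unfolding has_C1_partials_def
  proof (intro conjI allI impI)
    fix x y assume "(x, y) \<in> S"
    then have T: "Complex x y \<in> T" by (simp add: T_def c_def)
    have C: "((\<lambda>t. Complex t y) has_derivative (\<lambda>t. t *\<^sub>R 1)) (at x)"
      "((\<lambda>t. Complex x t) has_derivative (\<lambda>t. t *\<^sub>R \<i>)) (at y)"
      unfolding Complex_eq by (auto intro!: derivative_eq_intros simp: scaleR_conv_of_real)
    show "((\<lambda>t. h (Complex (fst (t, y)) (snd (t, y)))) has_vector_derivative P (x, y)) (at x)"
      "((\<lambda>t. h (Complex (fst (x, t)) (snd (x, t)))) has_vector_derivative Q (x, y)) (at y)"
      using has_derivative_compose[OF C(1) h[OF T]]
        has_derivative_compose[OF C(2) h[OF T]]
      by (auto simp: has_vector_derivative_def W_def c_def inner_complex_def mult_commute_abs)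
  qed (use P Q S(1) in \<open>auto intro: has_C1_partials_continuous_on\<close>)
  then show ?thesis by blast
qed

section \<open>Second partial derivatives and the class \<open>Ck_on 2\<close>\<close>

lemma has_C1_partials_transform:
  assumes S: "open S" and f: "has_C1_partials f fx fy S" and eq: "\<And>p. p \<in> S \<Longrightarrow> f p = g p"
  shows "has_C1_partials g fx fy S"
  unfolding has_C1_partials_def
proof (intro conjI allI impI)
  fix x y assume xy: "(x, y) \<in> S"
  \<comment> \<open>The horizontal and vertical slices of \<open>S\<close> are open, so
    \<open>f\<close> and \<open>g\<close> agree near the point along both lines.\<close>
  have "open ((\<lambda>t. (t, y)) -` S)" "open (Pair x -` S)"
    by (intro open_vimage S continuous_intros)+
  then show "((\<lambda>t. g (t, y)) has_vector_derivative fx (x, y)) (at x)"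
    "((\<lambda>t. g (x, t)) has_vector_derivative fy (x, y)) (at y)"
    using xy
      has_vector_derivative_transform_within_open[OF has_C1_partialsD(1)[OF f xy], of "(\<lambda>t. (t, y)) -` S" "\<lambda>t. g (t, y)"]
      has_vector_derivative_transform_within_open[OF has_C1_partialsD(2)[OF f xy], of "Pair x -` S" "\<lambda>t. g (x, t)"]
    by (auto simp: eq)
qed (use has_C1_partialsD(3,4)[OF f] in auto)

lemma has_C1_partials_partial:
  assumes "has_C1_partials f fx fy S" "p \<in> S"
  shows "partial_x f p = fx p" "partial_y f p = fy p"
  using has_C1_partialsD(1,2)[OF assms(1), of "fst p" "snd p", THEN vector_derivative_at] assms(2)
  by (simp_all add: partial_x_def partial_y_def)

text \<open>The mixed partials are kept apart: \<open>fxy\<close> is the y-partial of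
  \<open>fx\<close>, and \<open>fyx\<close> is the x-partial of \<open>fy\<close>.
  \<open>mixed_partials_eq\<close> identifies them on open sets.\<close>

definition has_C2_partials where
  "has_C2_partials f fx fy fxx fxy fyx fyy S \<longleftrightarrow>
     has_C1_partials f fx fy S \<and> has_C1_partials fx fxx fxy S \<and> has_C1_partials fy fyx fyy S"

lemma has_C2_partialsD:
  assumes "has_C2_partials f fx fy fxx fxy fyx fyy S"
  shows "has_C1_partials f fx fy S" "has_C1_partials fx fxx fxy S" "has_C1_partials fy fyx fyy S"
  using assms by (auto simp: has_C2_partials_def)

lemma has_C2_partials_partial:
  assumes S: "open S" and f: "has_C2_partials f fx fy fxx fxy fyx fyy S"
  shows "has_C1_partials (partial_x f) fxx fxy S" "has_C1_partials (partial_y f) fyx fyy S"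
  using has_C1_partials_partial[OF has_C2_partialsD(1)[OF f]]
    has_C1_partials_transform[OF S has_C2_partialsD(2)[OF f], of "partial_x f"]
    has_C1_partials_transform[OF S has_C2_partialsD(3)[OF f], of "partial_y f"]
  by simp_all

lemma has_C2_partials_imp_Ck_on:
  assumes S: "open S" and f: "has_C2_partials f fx fy fxx fxy fyx fyy S"
  shows "Ck_on 2 f S"
proof -
  note f2 = has_C2_partials_partial[OF S f]
  have diff: "(\<lambda>t. g (t, y)) differentiable at x \<and> (\<lambda>t. g (x, t)) differentiable at y"
    if "has_C1_partials g gx gy S" "(x, y) \<in> S" for g gx gy :: "real \<times> real \<Rightarrow> 'a" and x y
    using has_C1_partialsD(1,2)[OF that]
    by (auto simp: has_vector_derivative_def differentiable_def)
  have cont: "continuous_on S (partial_x g) \<and> continuous_on S (partial_y g)"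
    if "has_C1_partials g gx gy S" for g gx gy :: "real \<times> real \<Rightarrow> 'a"
    using has_C1_partialsD(3,4)[OF that] has_C1_partials_partial[OF that]
    by (metis (no_types, lifting) continuous_on_cong)
  show ?thesis
    using has_C2_partialsD(1)[OF f] f2 diff cont
    unfolding numeral_2_eq_2 Ck_on.simps by (fast intro!: ballI)
qed

lemma Ck_on_2_imp_has_C2_partials:
  assumes S: "open S" and f: "Ck_on 2 f S"
  shows "has_C2_partials f (partial_x f) (partial_y f) (partial_x (partial_x f))
    (partial_y (partial_x f)) (partial_x (partial_y f)) (partial_y (partial_y f)) S"
proof -
  have C1: "has_C1_partials g (partial_x g) (partial_y g) S"
    if "\<forall>(x, y)\<in>S. (\<lambda>t. g (t, y)) differentiable at x \<and> (\<lambda>t. g (x, t)) differentiable at y"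
      "continuous_on S (partial_x g)" "continuous_on S (partial_y g)" for g :: "real \<times> real \<Rightarrow> 'a"
    using that by (auto simp: has_C1_partials_def partial_x_def partial_y_def
        vector_derivative_works[symmetric])
  have f2: "has_C1_partials (partial_x f) (partial_x (partial_x f)) (partial_y (partial_x f)) S"
    "has_C1_partials (partial_y f) (partial_x (partial_y f)) (partial_y (partial_y f)) S"
    using f by (auto simp: numeral_2_eq_2 intro!: C1)
  \<comment> \<open>\<open>Ck_on 2\<close> states continuity for the second partials; that of the
    first partials follows from \<open>f2\<close>.\<close>
  moreover have "has_C1_partials f (partial_x f) (partial_y f) S"
    using f f2[THEN has_C1_partials_continuous_on[OF S]]
    by (intro C1) (simp_all add: numeral_2_eq_2)
  ultimately show ?thesis by (simp add: has_C2_partials_def)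
qed

section \<open>Minimal graphs\<close>

lemma closest_point_span_orthogonal:
  fixes y z :: "'a::euclidean_space"
  assumes y: "y \<in> span B" and z: "\<And>w. w \<in> span B \<Longrightarrow> orthogonal z w"
  shows "closest_point (span B) (y + z) = y"
proof (rule closest_point_unique[symmetric])
  show "\<forall>w\<in>span B. dist (y + z) y \<le> dist (y + z) w"
  proof
    fix w assume "w \<in> span B"
    \<comment> \<open>By Pythagoras, passing from \<open>y\<close> to another point \<open>w\<close>
      of the span adds the squared norm of \<open>y - w\<close> to the squared distance.\<close>
    then have "orthogonal z (y - w)" using y z span_diff by blast
    then have "norm z ^ 2 \<le> norm (z + (y - w)) ^ 2"
      by (simp add: norm_add_Pythagorean)
    then show "dist (y + z) y \<le> dist (y + z) w"
      by (simp add: dist_norm algebra_simps)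
  qed
qed (fact subspace_imp_convex[OF subspace_span] closed_span y)+

lemma normal_part_decomp:
  obtains y where "y \<in> tangent_plane X p" "v = y + normal_part X p v"
    "\<And>w. w \<in> tangent_plane X p \<Longrightarrow> orthogonal (normal_part X p v) w"
proof -
  obtain y z where *: "y \<in> tangent_plane X p" "\<And>w. w \<in> tangent_plane X p \<Longrightarrow> orthogonal z w" "v = y + z"
    using orthogonal_subspace_decomp_exists[of "{partial_x X p, partial_y X p}" v]
    unfolding tangent_plane_def by metis
  then have "normal_part X p v = z"
    unfolding normal_part_def tangent_plane_def by (simp add: closest_point_span_orthogonal)
  with * that show ?thesis by metis
qed

lemma normal_part_unique:
  assumes "y \<in> tangent_plane X p" "\<And>w. w \<in> tangent_plane X p \<Longrightarrow> orthogonal z w"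
  shows "normal_part X p (y + z) = z"
  using assms unfolding normal_part_def tangent_plane_def by (simp add: closest_point_span_orthogonal)

text \<open>Sums and multiples of orthogonal decompositions are orthogonal decompositions, and these
  are unique. Linearity turns the mean curvature into the normal part of a single vector.\<close>

lemma normal_part_linear: "linear (normal_part X p)"
proof (rule linearI)
  fix v w
  obtain a where a: "a \<in> tangent_plane X p" "v = a + normal_part X p v"
    "\<And>u. u \<in> tangent_plane X p \<Longrightarrow> orthogonal (normal_part X p v) u"
    using normal_part_decomp[where X=X and p=p and v=v] by metis
  obtain b where b: "b \<in> tangent_plane X p" "w = b + normal_part X p w"
    "\<And>u. u \<in> tangent_plane X p \<Longrightarrow> orthogonal (normal_part X p w) u"
    using normal_part_decomp[where X=X and p=p and v=w] by metis
  have "normal_part X p ((a + b) + (normal_part X p v + normal_part X p w))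
      = normal_part X p v + normal_part X p w"
    using a b
    by (intro normal_part_unique) (auto simp: tangent_plane_def span_add orthogonal_clauses)
  moreover have "(a + b) + (normal_part X p v + normal_part X p w) = v + w"
    using a(2) b(2) by (metis add.assoc add.left_commute)
  ultimately show "normal_part X p (v + w) = normal_part X p v + normal_part X p w" by simp
  fix r :: real
  have "normal_part X p (r *\<^sub>R a + r *\<^sub>R normal_part X p v) = r *\<^sub>R normal_part X p v"
    using a by (intro normal_part_unique) (auto simp: tangent_plane_def span_mul orthogonal_clauses)
  then show "normal_part X p (r *\<^sub>R v) = r *\<^sub>R normal_part X p v"
    using a(2) by (metis scaleR_add_right)
qed

lemma normal_part_eq_0_iff: "normal_part X p v = 0 \<longleftrightarrow> v \<in> tangent_plane X p"
proof
  assume "normal_part X p v = 0"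
  then show "v \<in> tangent_plane X p" by (metis add.right_neutral normal_part_decomp)
next
  assume "v \<in> tangent_plane X p"
  then show "normal_part X p v = 0"
    using normal_part_unique[of v X p 0] by (simp add: orthogonal_clauses)
qed

section \<open>Metric and mean curvature of a graph\<close>

lemma has_C1_partials_Pair:
  assumes "has_C1_partials f fx fy S" "has_C1_partials g gx gy S"
  shows "has_C1_partials (\<lambda>p. (f p, g p)) (\<lambda>p. (fx p, gx p)) (\<lambda>p. (fy p, gy p)) S"
  using assms unfolding has_C1_partials_def
  by (auto intro!: has_vector_derivative_Pair continuous_intros)

lemma has_C2_partials_Pair:
  assumes "has_C2_partials f fx fy fxx fxy fyx fyy S" "has_C2_partials g gx gy gxx gxy gyx gyy S"
  shows "has_C2_partials (\<lambda>p. (f p, g p)) (\<lambda>p. (fx p, gx p)) (\<lambda>p. (fy p, gy p))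
    (\<lambda>p. (fxx p, gxx p)) (\<lambda>p. (fxy p, gxy p)) (\<lambda>p. (fyx p, gyx p)) (\<lambda>p. (fyy p, gyy p)) S"
  using assms by (simp add: has_C2_partials_def has_C1_partials_Pair)

lemma has_C2_partials_graph_map:
  assumes "has_C2_partials f fx fy fxx fxy fyx fyy S"
  shows "has_C2_partials (graph_map f) (\<lambda>p. ((1, 0), fx p)) (\<lambda>p. ((0, 1), fy p))
    (\<lambda>p. (0, fxx p)) (\<lambda>p. (0, fxy p)) (\<lambda>p. (0, fyx p)) (\<lambda>p. (0, fyy p)) S"
proof -
  have "has_C1_partials (\<lambda>p. c) (\<lambda>p. 0) (\<lambda>p. 0) S" for c :: "real \<times> real"
    by (simp add: has_C1_partials_def)
  moreover have "has_C1_partials (\<lambda>p. p) (\<lambda>p. (1, 0)) (\<lambda>p. (0, 1)) S"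
    by (auto simp: has_C1_partials_def intro!: has_vector_derivative_Pair derivative_intros)
  ultimately show ?thesis
    using has_C2_partials_Pair[OF _ assms, of "\<lambda>p. p" "\<lambda>p. (1, 0)" "\<lambda>p. (0, 1)" "\<lambda>p. 0" "\<lambda>p. 0" "\<lambda>p. 0" "\<lambda>p. 0"]
    by (simp add: has_C2_partials_def graph_map_def[abs_def])
qed

lemma metric_graph_map_inner:
  assumes "has_C1_partials (graph_map f) (\<lambda>p. ((1, 0), fx p)) (\<lambda>p. ((0, 1), fy p)) S" "p \<in> S"
  shows "metric_E (graph_map f) p = 1 + fx p \<bullet> fx p"
    and "metric_F (graph_map f) p = fx p \<bullet> fy p"
    and "metric_G (graph_map f) p = 1 + fy p \<bullet> fy p"
  using has_C1_partials_partial[OF assms]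
  by (simp_all add: metric_E_def metric_F_def metric_G_def inner_prod_def)

text \<open>By Cauchy-Schwarz the determinant is at least
  \<open>1 + u \<bullet> u + v \<bullet> v\<close>. Hence every graph is an immersion.\<close>

lemma gram_det_graph_pos:
  fixes u v :: "'a::real_inner"
  shows "(1 + u \<bullet> u) * (1 + v \<bullet> v) - (u \<bullet> v)\<^sup>2 > 0"
proof -
  have "(1 + u \<bullet> u) * (1 + v \<bullet> v) = 1 + u \<bullet> u + v \<bullet> v + (u \<bullet> u) * (v \<bullet> v)"
    by (simp add: algebra_simps)
  then show ?thesis
    using Cauchy_Schwarz_ineq[of u v] inner_ge_zero[of u] inner_ge_zero[of v] by linarith
qed

text \<open>The second partials of a graph have zero base component. The mean curvature is therefore
  a nonzero multiple of the normal part of \<open>(0, L)\<close>, with \<open>L\<close> the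
  left-hand side of the equation, and vanishes iff \<open>(0, L)\<close> is tangent.\<close>

lemma minimal_surface_graph_map_iff:
  fixes f :: "real \<times> real \<Rightarrow> 'a::euclidean_space"
  assumes S: "open S" and f: "has_C2_partials f fx fy fxx fxy fyx fyy S"
  shows "minimal_surface S (graph_map f) \<longleftrightarrow>
    (\<forall>p\<in>S. (1 + fy p \<bullet> fy p) *\<^sub>R fxx p - (2 * (fx p \<bullet> fy p)) *\<^sub>R fxy p
        + (1 + fx p \<bullet> fx p) *\<^sub>R fyy p = 0)"
proof -
  let ?X = "graph_map f"
  note X = has_C2_partials_graph_map[OF f]
  note X1 = has_C2_partialsD(1)[OF X]
  have "mean_curvature ?X p = 0 \<longleftrightarrow> (1 + fy p \<bullet> fy p) *\<^sub>R fxx p - (2 * (fx p \<bullet> fy p)) *\<^sub>R fxy p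
        + (1 + fx p \<bullet> fx p) *\<^sub>R fyy p = 0" (is "_ \<longleftrightarrow> ?L p = 0") if p: "p \<in> S" for p
  proof -
    let ?E = "1 + fx p \<bullet> fx p" and ?F = "fx p \<bullet> fy p" and ?G = "1 + fy p \<bullet> fy p"
    note met = metric_graph_map_inner[OF X1 p]
    interpret linear "normal_part ?X p" by (rule normal_part_linear)
    have "mean_curvature ?X p = (1 / (2 * (?E * ?G - ?F\<^sup>2))) *\<^sub>R
        normal_part ?X p (?G *\<^sub>R (0, fxx p) - (2 * ?F) *\<^sub>R (0, fxy p) + ?E *\<^sub>R (0, fyy p))"
      unfolding mean_curvature_def met
      using has_C1_partials_partial[OF has_C2_partials_partial(1)[OF S X] p]
        has_C1_partials_partial(2)[OF has_C2_partials_partial(2)[OF S X] p]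
      by (simp only: add diff scale)
    moreover have "?E * ?G - ?F\<^sup>2 \<noteq> 0" using gram_det_graph_pos[of "fx p" "fy p"] by simp
    ultimately have "mean_curvature ?X p = 0 \<longleftrightarrow>
        ?G *\<^sub>R (0, fxx p) - (2 * ?F) *\<^sub>R (0, fxy p) + ?E *\<^sub>R (0, fyy p) \<in> tangent_plane ?X p"
      by (simp add: normal_part_eq_0_iff)
    also have "\<dots> \<longleftrightarrow> (0, ?L p) \<in> span {((1::real, 0::real), fx p), ((0, 1), fy p)}"
      using has_C1_partials_partial[OF X1 p] by (simp add: tangent_plane_def)
    \<comment> \<open>The base components (1, 0) and (0, 1) of the spanning vectors force both
      coefficients to be 0.\<close>
    also have "\<dots> \<longleftrightarrow> ?L p = 0"
      by (auto simp: span_breakdown_eq zero_prod_def)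
    finally show ?thesis .
  qed
  moreover have "metric_E ?X p * metric_G ?X p - (metric_F ?X p)\<^sup>2 > 0" if "p \<in> S" for p
    using metric_graph_map_inner[OF X1 that] gram_det_graph_pos by metis
  ultimately show ?thesis
    unfolding minimal_surface_def using has_C2_partials_imp_Ck_on[OF S X] by blast
qed
section \<open>The conjugate gradient graph\<close>

lemma has_C1_partials_bilinear:
  assumes S: "open S" and B: "bounded_bilinear B"
    and f: "has_C1_partials f fx fy S" and g: "has_C1_partials g gx gy S"
  shows "has_C1_partials (\<lambda>p. B (f p) (g p)) (\<lambda>p. B (f p) (gx p) + B (fx p) (g p))
    (\<lambda>p. B (f p) (gy p) + B (fy p) (g p)) S"
  unfolding has_C1_partials_def
proof (intro conjI allI impI)
  note cont = has_C1_partials_continuous_on[OF S f] has_C1_partials_continuous_on[OF S g]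
    has_C1_partialsD(3,4)[OF f] has_C1_partialsD(3,4)[OF g]
  show "continuous_on S (\<lambda>p. B (f p) (gx p) + B (fx p) (g p))"
    "continuous_on S (\<lambda>p. B (f p) (gy p) + B (fy p) (g p))"
    by (intro continuous_on_add bounded_bilinear.continuous_on[OF B] cont)+
qed (intro bounded_bilinear.has_vector_derivative[OF B] has_C1_partialsD(1,2)[OF f]
    has_C1_partialsD(1,2)[OF g]; assumption)+

lemmas has_C1_partials_inner = has_C1_partials_bilinear[OF _ bounded_bilinear_inner]
lemmas has_C1_partials_mult =
  has_C1_partials_bilinear[where B="(*)", OF _ bounded_bilinear_mult]

lemma has_C1_partials_diff:
  assumes f: "has_C1_partials f fx fy S" and g: "has_C1_partials g gx gy S"
  shows "has_C1_partials (\<lambda>p. f p - g p) (\<lambda>p. fx p - gx p) (\<lambda>p. fy p - gy p) S"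
  unfolding has_C1_partials_def
  by (intro conjI allI impI has_vector_derivative_diff continuous_on_diff
      has_C1_partialsD[OF f] has_C1_partialsD[OF g]; assumption)

lemma has_C1_partials_const_add:
  assumes f: "has_C1_partials f fx fy S"
  shows "has_C1_partials (\<lambda>p. c + f p) fx fy S"
  using has_C1_partialsD[OF f]
  by (simp add: has_C1_partials_def has_vector_derivative_add_const add.commute[of c])

text \<open>Both partials carry the denominator \<open>2 * C p * sqrt (C p)\<close>, which depends
  on \<open>C\<close> alone. Equality of partials of two such quotients thus reduces to equality of
  numerators.\<close>

lemma has_C1_partials_div_sqrt:
  fixes A C :: "real \<times> real \<Rightarrow> real"
  assumes S: "open S" and A: "has_C1_partials A Ax Ay S" and C: "has_C1_partials C Cx Cy S"
    and pos: "\<And>p. p \<in> S \<Longrightarrow> C p > 0"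
  shows "has_C1_partials (\<lambda>p. A p / sqrt (C p))
    (\<lambda>p. (2 * C p * Ax p - A p * Cx p) / (2 * C p * sqrt (C p)))
    (\<lambda>p. (2 * C p * Ay p - A p * Cy p) / (2 * C p * sqrt (C p))) S"
proof -
  have 1: "((\<lambda>t. a t / sqrt (c t)) has_vector_derivative (2 * c t * a' - a t * c') / (2 * c t * sqrt (c t))) (at t)"
    if "(a has_vector_derivative a') (at t)" "(c has_vector_derivative c') (at t)" "c t > 0"
    for a c :: "real \<Rightarrow> real" and a' c' t
  proof -
    note that[unfolded has_real_derivative_iff_has_vector_derivative[symmetric], derivative_intros]
    have "((\<lambda>t. a t / sqrt (c t)) has_real_derivative
        (a' * sqrt (c t) - a t * (c' * (inverse (sqrt (c t)) / 2))) / (sqrt (c t) * sqrt (c t))) (at t)"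
      using that(3) by (auto intro!: derivative_eq_intros)
    moreover have "(a' * sqrt (c t) - a t * (c' * (inverse (sqrt (c t)) / 2))) / (sqrt (c t) * sqrt (c t))
        = (2 * c t * a' - a t * c') / (2 * c t * sqrt (c t))"
    proof -
      \<comment> \<open>Naming the square root \<open>s\<close> leaves a rational identity in
        \<open>s\<close>.\<close>
      have "c t = sqrt (c t) * sqrt (c t)" "sqrt (c t) > 0" using that(3) by auto
      then obtain s where "c t = s * s" "sqrt (c t) = s" "s > 0" by metis
      then show ?thesis by (simp add: field_simps)
    qed
    ultimately show ?thesis
      by (simp add: has_real_derivative_iff_has_vector_derivative)
  qed
  have cont: "continuous_on S (\<lambda>p. (2 * C p * Ax p - A p * Cx p) / (2 * C p * sqrt (C p)))"
    "continuous_on S (\<lambda>p. (2 * C p * Ay p - A p * Cy p) / (2 * C p * sqrt (C p)))"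
    using has_C1_partialsD(3,4)[OF A] has_C1_partialsD(3,4)[OF C] pos
      has_C1_partials_continuous_on[OF S A] has_C1_partials_continuous_on[OF S C]
    by (auto intro!: continuous_intros simp: less_le)
  show ?thesis
    unfolding has_C1_partials_def
    using has_C1_partialsD(1,2)[OF A] has_C1_partialsD(1,2)[OF C] pos cont
    by (auto intro!: 1)
qed

text \<open>The two differences of sides are \<open>2 F H\<^sub>1 - 2 E H\<^sub>2\<close> and \<open>2 G H\<^sub>1 - 2 F H\<^sub>2\<close>, where
  \<open>H\<^sub>1, H\<^sub>2\<close> are the left-hand sides of the hypotheses. For a graph with first partials \<open>u, v\<close> and
  second partials \<open>r, s, t\<close> one takes \<open>a = u \<bullet> r\<close>, \<open>b = u \<bullet> s\<close>, \<open>c = v \<bullet> r\<close>, \<open>d = v \<bullet> s\<close>,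
  \<open>e = u \<bullet> t\<close>, \<open>g = v \<bullet> t\<close>.\<close>

lemma minimal_graph_closedness_identities:
  fixes E F G C a b c d e g :: real
  assumes 1: "G * a - 2 * F * b + E * e = 0" and 2: "G * c - 2 * F * d + E * g = 0"
    and C: "C = E * G - F * F"
  shows "2 * C * (b + b) - E * (E * (g + g) + (b + b) * G - (F * (e + d) + (e + d) * F))
      = 2 * C * (b + c) - F * (E * (d + d) + (a + a) * G - (F * (b + c) + (b + c) * F))"
    and "2 * C * (e + d) - F * (E * (g + g) + (b + b) * G - (F * (e + d) + (e + d) * F))
      = 2 * C * (d + d) - G * (E * (d + d) + (a + a) * G - (F * (b + c) + (b + c) * F))"
proof -
  have "2 * F * (G * a - 2 * F * b + E * e) - 2 * E * (G * c - 2 * F * d + E * g) = 0"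
    "2 * G * (G * a - 2 * F * b + E * e) - 2 * F * (G * c - 2 * F * d + E * g) = 0"
    using 1 2 by simp_all
  then show "2 * C * (b + b) - E * (E * (g + g) + (b + b) * G - (F * (e + d) + (e + d) * F))
      = 2 * C * (b + c) - F * (E * (d + d) + (a + a) * G - (F * (b + c) + (b + c) * F))"
    and "2 * C * (e + d) - F * (E * (g + g) + (b + b) * G - (F * (e + d) + (e + d) * F))
      = 2 * C * (d + d) - G * (E * (d + d) + (a + a) * G - (F * (b + c) + (b + c) * F))"
    unfolding C by (simp_all add: algebra_simps)
qed

text \<open>Since \<open>p r - q\<^sup>2 = 1\<close>, the graph of \<open>(M, N)\<close> has the metric \<open>(p + r) (p dx\<^sup>2 + 2 q dx dy + r dy\<^sup>2)\<close>,
  so its minimal surface equations are the partial derivatives of \<open>p r - q\<^sup>2 = 1\<close>.\<close>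

lemma minimal_surface_unimodular_jacobian:
  fixes M N :: "real \<times> real \<Rightarrow> real"
  assumes S: "open S"
    and M: "has_C1_partials M p q S" and N: "has_C1_partials N q r S"
    and p: "has_C1_partials p px py S" and q: "has_C1_partials q qx qy S"
    and r: "has_C1_partials r rx ry S"
    and det: "\<And>z. z \<in> S \<Longrightarrow> p z * r z - q z * q z = 1"
    and closed: "\<And>z. z \<in> S \<Longrightarrow> py z = qx z" "\<And>z. z \<in> S \<Longrightarrow> qy z = rx z"
  shows "minimal_surface S (graph_map (\<lambda>z. (M z, N z)))"
proof -
  have C2: "has_C2_partials (\<lambda>z. (M z, N z)) (\<lambda>z. (p z, q z)) (\<lambda>z. (q z, r z))
      (\<lambda>z. (px z, qx z)) (\<lambda>z. (py z, qy z)) (\<lambda>z. (qx z, rx z)) (\<lambda>z. (qy z, ry z)) S"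
    using assms by (simp add: has_C2_partials_def has_C1_partials_Pair)
  have d: "has_C1_partials (\<lambda>z. p z * r z - q z * q z)
      (\<lambda>z. p z * rx z + px z * r z - (q z * qx z + qx z * q z))
      (\<lambda>z. p z * ry z + py z * r z - (q z * qy z + qy z * q z)) S"
    by (intro has_C1_partials_diff has_C1_partials_mult p q r S)
  \<comment> \<open>The determinant equals 1 on \<open>S\<close>, so the formulas for its partials
    are also partials of a constant and vanish.\<close>
  have d1: "has_C1_partials (\<lambda>z. 1::real)
      (\<lambda>z. p z * rx z + px z * r z - (q z * qx z + qx z * q z))
      (\<lambda>z. p z * ry z + py z * r z - (q z * qy z + qy z * q z)) S"
    by (rule has_C1_partials_transform[OF S d det])
  have d0: "p z * rx z + px z * r z - (q z * qx z + qx z * q z) = 0"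
    "p z * ry z + py z * r z - (q z * qy z + qy z * q z) = 0" if "z \<in> S" for z
    using has_C1_partials_partial[OF d1 that]
    by (simp_all add: partial_x_def partial_y_def)
  show ?thesis
    unfolding minimal_surface_graph_map_iff[OF S C2]
  proof
    fix z assume z: "z \<in> S"
    have E: "1 + (p z * p z + q z * q z) = p z * (p z + r z)"
      and G: "1 + (q z * q z + r z * r z) = r z * (p z + r z)"
      and F: "p z * q z + q z * r z = q z * (p z + r z)"
      using det[OF z] by (simp_all add: algebra_simps)
    \<comment> \<open>After \<open>py = qx\<close> and \<open>qy = rx\<close>, the two components of
      the minimal surface equation are \<open>p + r\<close> times the x- and y-partials of the
      determinant.\<close>
    have H1: "r z * (p z + r z) * px z - 2 * (q z * (p z + r z)) * py z + p z * (p z + r z) * qy z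
        = (p z + r z) * (p z * rx z + px z * r z - (q z * qx z + qx z * q z))"
      using closed[OF z] by (simp add: algebra_simps)
    have H2: "r z * (p z + r z) * qx z - 2 * (q z * (p z + r z)) * qy z + p z * (p z + r z) * ry z
        = (p z + r z) * (p z * ry z + py z * r z - (q z * qy z + qy z * q z))"
      using closed[OF z] by (simp add: algebra_simps)
    show "(1 + (q z, r z) \<bullet> (q z, r z)) *\<^sub>R (px z, qx z)
        - (2 * ((p z, q z) \<bullet> (q z, r z))) *\<^sub>R (py z, qy z)
        + (1 + (p z, q z) \<bullet> (p z, q z)) *\<^sub>R (qy z, ry z) = 0"
      using H1 H2 unfolding d0[OF z] by (simp add: E F G zero_prod_def)
  qed
qed

theorem theorem11:
  fixes \<Omega> :: "(real \<times> real) set"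
    and f :: "real \<times> real \<Rightarrow> real ^ 'n"
  assumes "open \<Omega>" and "connected \<Omega>" and "\<Omega> \<noteq> {}" and "simply_connected \<Omega>"
    and "Ck_on 2 f \<Omega>"
    and "minimal_surface \<Omega> (graph_map f)"
  shows "\<exists>M N :: real \<times> real \<Rightarrow> real.
    (\<forall>(x, y)\<in>\<Omega>.
      ((\<lambda>t. M (t, y)) has_real_derivative
        metric_E (graph_map f) (x, y) / area_density (graph_map f) (x, y)) (at x) \<and>
      ((\<lambda>t. M (x, t)) has_real_derivative
        metric_F (graph_map f) (x, y) / area_density (graph_map f) (x, y)) (at y) \<and>
      ((\<lambda>t. N (t, y)) has_real_derivative
        metric_F (graph_map f) (x, y) / area_density (graph_map f) (x, y)) (at x) \<and>
      ((\<lambda>t. N (x, t)) has_real_derivative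
        metric_G (graph_map f) (x, y) / area_density (graph_map f) (x, y)) (at y)) \<and>
    minimal_gradient_graph \<Omega> M N"
proof -
  note S = \<open>open \<Omega>\<close>
  define u v where "u = partial_x f" and "v = partial_y f"
  \<comment> \<open>Here \<open>a\<close>, \<open>b\<close>, \<open>c\<close> are the xx-, xy- and
    yy-partials of \<open>f\<close>, with \<open>b\<close> the y-partial of \<open>u\<close>;
    \<open>b'\<close> is the x-partial of \<open>v\<close>.\<close>
  obtain a b b' c where f2: "has_C2_partials f u v a b b' c \<Omega>"
    using Ck_on_2_imp_has_C2_partials[OF S \<open>Ck_on 2 f \<Omega>\<close>] unfolding u_def v_def by blast
  note u = has_C2_partialsD(2)[OF f2] and v = has_C2_partialsD(3)[OF f2]
  have b': "b' z = b z" if "z \<in> \<Omega>" for z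
    using mixed_partials_eq[OF S that has_C2_partialsD[OF f2]] by simp
  have eq0: "(1 + v z \<bullet> v z) *\<^sub>R a z - (2 * (u z \<bullet> v z)) *\<^sub>R b z + (1 + u z \<bullet> u z) *\<^sub>R c z = 0"
    if "z \<in> \<Omega>" for z
    using \<open>minimal_surface \<Omega> (graph_map f)\<close> minimal_surface_graph_map_iff[OF S f2] that by blast
  define E F G where "E z = 1 + u z \<bullet> u z" and "F z = u z \<bullet> v z" and "G z = 1 + v z \<bullet> v z" for z
  \<comment> \<open>Pairing the vector equation with \<open>w\<close> gives scalar equations; they
    are used for \<open>w = u z\<close> and \<open>w = v z\<close>.\<close>
  have eq: "G z * (w \<bullet> a z) - 2 * F z * (w \<bullet> b z) + E z * (w \<bullet> c z) = 0" if "z \<in> \<Omega>" for z w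
    using arg_cong[OF eq0[OF that], of "\<lambda>x. w \<bullet> x"]
    by (simp add: E_def F_def G_def inner_add_right inner_diff_right)
  define C where "C z = E z * G z - F z * F z" for z
  have Cpos: "C z > 0" for z
    using gram_det_graph_pos[of "u z" "v z"] by (simp add: C_def E_def F_def G_def power2_eq_square)
  have E: "has_C1_partials E (\<lambda>z. u z \<bullet> a z + a z \<bullet> u z) (\<lambda>z. u z \<bullet> b z + b z \<bullet> u z) \<Omega>"
    unfolding E_def[abs_def] by (intro has_C1_partials_const_add has_C1_partials_inner S u)
  have F: "has_C1_partials F (\<lambda>z. u z \<bullet> b' z + a z \<bullet> v z) (\<lambda>z. u z \<bullet> c z + b z \<bullet> v z) \<Omega>"
    unfolding F_def[abs_def] by (intro has_C1_partials_inner S u v)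
  have G: "has_C1_partials G (\<lambda>z. v z \<bullet> b' z + b' z \<bullet> v z) (\<lambda>z. v z \<bullet> c z + c z \<bullet> v z) \<Omega>"
    unfolding G_def[abs_def] by (intro has_C1_partials_const_add has_C1_partials_inner S v)
  note C = has_C1_partials_diff[OF has_C1_partials_mult[OF S E G] has_C1_partials_mult[OF S F F],
      folded C_def]
  define p q r where "p z = E z / sqrt (C z)" and "q z = F z / sqrt (C z)"
    and "r z = G z / sqrt (C z)" for z
  note pqr = has_C1_partials_div_sqrt[OF S E C Cpos, folded p_def]
    has_C1_partials_div_sqrt[OF S F C Cpos, folded q_def]
    has_C1_partials_div_sqrt[OF S G C Cpos, folded r_def]
  obtain px py qx qy rx ry where
    p: "has_C1_partials p px py \<Omega>" and q: "has_C1_partials q qx qy \<Omega>"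
    and r: "has_C1_partials r rx ry \<Omega>"
    and closed: "\<And>z. z \<in> \<Omega> \<Longrightarrow> py z = qx z" "\<And>z. z \<in> \<Omega> \<Longrightarrow> qy z = rx z"
  \<comment> \<open>The witnesses are the quotient rule formulas, so closedness compares numerators
    over a common denominator.\<close>
  proof (rule that[OF pqr])
    fix z assume z: "z \<in> \<Omega>"
    note ids = minimal_graph_closedness_identities[OF eq[OF z, of "u z"] eq[OF z, of "v z"] C_def]
    \<comment> \<open>These put the second partial last in each inner product and replace
      \<open>b'\<close> by \<open>b\<close>, as the identities expect.\<close>
    note comm = b'[OF z] inner_commute[of "a z"] inner_commute[of "b z"] inner_commute[of "c z"]
    show "(2 * C z * (u z \<bullet> b z + b z \<bullet> u z) -
          E z * (E z * (v z \<bullet> c z + c z \<bullet> v z) + (u z \<bullet> b z + b z \<bullet> u z) * G z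
            - (F z * (u z \<bullet> c z + b z \<bullet> v z) + (u z \<bullet> c z + b z \<bullet> v z) * F z)))
        / (2 * C z * sqrt (C z))
      = (2 * C z * (u z \<bullet> b' z + a z \<bullet> v z) -
          F z * (E z * (v z \<bullet> b' z + b' z \<bullet> v z) + (u z \<bullet> a z + a z \<bullet> u z) * G z
            - (F z * (u z \<bullet> b' z + a z \<bullet> v z) + (u z \<bullet> b' z + a z \<bullet> v z) * F z)))
        / (2 * C z * sqrt (C z))"
      unfolding comm ids(1) ..
    show "(2 * C z * (u z \<bullet> c z + b z \<bullet> v z) -
          F z * (E z * (v z \<bullet> c z + c z \<bullet> v z) + (u z \<bullet> b z + b z \<bullet> u z) * G z
            - (F z * (u z \<bullet> c z + b z \<bullet> v z) + (u z \<bullet> c z + b z \<bullet> v z) * F z)))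
        / (2 * C z * sqrt (C z))
      = (2 * C z * (v z \<bullet> b' z + b' z \<bullet> v z) -
          G z * (E z * (v z \<bullet> b' z + b' z \<bullet> v z) + (u z \<bullet> a z + a z \<bullet> u z) * G z
            - (F z * (u z \<bullet> b' z + a z \<bullet> v z) + (u z \<bullet> b' z + a z \<bullet> v z) * F z)))
        / (2 * C z * sqrt (C z))"
      unfolding comm ids(2) ..
  qed
  obtain M where M: "has_C1_partials M p q \<Omega>"
    using closed_form_potential[OF S \<open>simply_connected \<Omega>\<close> p q closed(1)] by blast
  obtain N where N: "has_C1_partials N q r \<Omega>"
    using closed_form_potential[OF S \<open>simply_connected \<Omega>\<close> q r closed(2)] by blast
  \<comment> \<open>The y-partial of \<open>M\<close> and the x-partial of \<open>N\<close> are the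
    same function \<open>q\<close>, so \<open>M dx + N dy\<close> is closed.\<close>
  obtain h where h: "has_C1_partials h M N \<Omega>"
    using closed_form_potential[OF S \<open>simply_connected \<Omega>\<close> M N] by blast
  have det: "p z * r z - q z * q z = 1" for z
    using Cpos[of z] by (simp add: p_def q_def r_def C_def divide_simps)
  have "minimal_surface \<Omega> (graph_map (\<lambda>z. (M z, N z)))"
    by (rule minimal_surface_unimodular_jacobian[OF S M N p q r det closed])
  moreover have "gradient_graph \<Omega> M N"
    unfolding gradient_graph_def has_real_derivative_iff_has_vector_derivative
    using has_C1_partialsD(1,2)[OF h] by blast
  \<comment> \<open>On \<Omega> the metric coefficients are \<open>E\<close>, \<open>F\<close>,
    \<open>G\<close> and the area density is \<open>sqrt (C z)\<close>.\<close>
  moreover have "metric_E (graph_map f) z / area_density (graph_map f) z = p z"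
    "metric_F (graph_map f) z / area_density (graph_map f) z = q z"
    "metric_G (graph_map f) z / area_density (graph_map f) z = r z" if "z \<in> \<Omega>" for z
    using metric_graph_map_inner[OF has_C2_partialsD(1)[OF has_C2_partials_graph_map[OF f2]] that]
    by (simp_all add: area_density_def p_def q_def r_def C_def E_def F_def G_def power2_eq_square)
  ultimately show ?thesis
    unfolding minimal_gradient_graph_def has_real_derivative_iff_has_vector_derivative
    using has_C1_partialsD(1,2)[OF M] has_C1_partialsD(1,2)[OF N]
    by (intro exI[of _ M] exI[of _ N]) auto
qed

end
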